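(* Let $A\in\mathbb{R}^{d\times d}$ be an invertible matrix, let $a(x)=Ax$, let $\psi:\mathbb{R}^d\to[0,\infty)$ be a nonnegative bounded function supported in the unit ball of $\mathbb{R}^d$, and let $K(x,y)=\psi(y-a(x))+\psi(x-a(y))$. Then $$\lim_{p\to\infty}[\lambda_{1,p}(\mathbb{R}^d)]^{1/p}=\lambda_{1,\infty}(\mathbb{R}^d)=0.$$
   Context: For $1\le p<\infty$, $$\lambda_{1,p}(\mathbb{R}^d)=\inf_{u\in L^p(\mathbb{R}^d),\,u\ne 0}\frac{\int_{\mathbb{R}^d}\int_{\mathbb{R}^d}K(x,y)|u(x)-u(y)|^p\,dx\,dy}{\int_{\mathbb{R}^d}|u|^p(x)\,dx},$$ and $$\lambda_{1,\infty}(\mathbb{R}^d)=\inf\left\{\frac{\|u(x)-u(y)\|_{L^\infty(x,y\in \mathrm{supp}(u);\,K(x,y)>0)}}{\|u\|_{L^\infty(\mathrm{supp}(u))}}:\ u\in L^\infty(\mathbb{R}^d)\text{ compactly supported},\ u\neq 0\right\},$$ where the norm in the numerator is the essential supremum of $|u(x)-u(y)|$ over the pairs $(x,y)\in\mathrm{supp}(u)\times\mathrm{supp}(u)$ with $K(x,y)>0$ (understood as $0$ if this set of pairs is null). *)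

theory Defs
  imports "HOL-Analysis.Analysis" "HOL-Probability.Essential_Supremum"
begin

text \<open>
  All integrals are Lebesgue integrals with values in the extended nonnegative reals. Elements of
  the Lebesgue spaces are represented by Lebesgue measurable functions, so ``nonzero''
  means ``not almost everywhere zero''.
\<close>

definition L_space :: "real \<Rightarrow> ((real ^ 'n) \<Rightarrow> real) set" where
  "L_space p = {u. u \<in> borel_measurable lebesgue \<and>
     (\<integral>\<^sup>+ x. ennreal (\<bar>u x\<bar> powr p) \<partial>lebesgue) < \<infinity>}"

definition lambda1 :: "real \<Rightarrow> (real ^ 'n \<Rightarrow> real ^ 'n \<Rightarrow> real) \<Rightarrow> ennreal" where
  "lambda1 p K =
     (INF u \<in> {u \<in> L_space p. \<not> (AE x in lebesgue. u x = 0)}.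
        (\<integral>\<^sup>+ y. (\<integral>\<^sup>+ x. ennreal (K x y * \<bar>u x - u y\<bar> powr p) \<partial>lebesgue) \<partial>lebesgue)
        / (\<integral>\<^sup>+ x. ennreal (\<bar>u x\<bar> powr p) \<partial>lebesgue))"

text \<open>
  The essential supremum of \<open>\<bar>f\<bar>\<close> over a Lebesgue measurable set \<open>S\<close>. Since it is taken in the
  extended nonnegative reals, it is \<open>0\<close> if \<open>S\<close> is a null set.
\<close>

definition Linf_norm_on :: "'a::euclidean_space set \<Rightarrow> ('a \<Rightarrow> real) \<Rightarrow> ennreal" where
  "Linf_norm_on S f = esssup (restrict_space lebesgue S) (\<lambda>x. ennreal \<bar>f x\<bar>)"

definition Linf_space :: "((real ^ 'n) \<Rightarrow> real) set" where
  "Linf_space = {u. u \<in> borel_measurable lebesgue \<and> Linf_norm_on UNIV u < \<infinity>}"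

text \<open>
  The support of an element of a Lebesgue space: the complement of the largest open set on which
  \<open>u\<close> vanishes almost everywhere. Unlike the closure of \<open>{x. u x \<noteq> 0}\<close>, this closed set does not
  depend on the chosen representative.
\<close>

definition ess_support :: "((real ^ 'n) \<Rightarrow> real) \<Rightarrow> (real ^ 'n) set" where
  "ess_support u = - \<Union>{U. open U \<and> (AE x in lebesgue. x \<in> U \<longrightarrow> u x = 0)}"

definition lambda1_inf :: "(real ^ 'n \<Rightarrow> real ^ 'n \<Rightarrow> real) \<Rightarrow> ennreal" where
  "lambda1_inf K =
     (INF u \<in> {u \<in> Linf_space. compact (ess_support u) \<and> \<not> (AE x in lebesgue. u x = 0)}.
        Linf_norm_on {(x, y). x \<in> ess_support u \<and> y \<in> ess_support u \<and> K x y > 0}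
          (\<lambda>(x, y). u x - u y)
        / Linf_norm_on (ess_support u) u)"

definition kernel_of ::
  "(real ^ 'n \<Rightarrow> real) \<Rightarrow> (real ^ 'n \<Rightarrow> real ^ 'n) \<Rightarrow> real ^ 'n \<Rightarrow> real ^ 'n \<Rightarrow> real" where
  "kernel_of \<psi> a x y = \<psi> (y - a x) + \<psi> (x - a y)"

text \<open>\<open>x\<close> to the power \<open>r\<close>, for exponents \<open>r > 0\<close> only.\<close>

definition ennreal_powr :: "ennreal \<Rightarrow> real \<Rightarrow> ennreal" where
  "ennreal_powr x r = (if x = \<infinity> then \<infinity> else ennreal (enn2real x powr r))"

end

theory Submission
  imports Defs
begin

text \<open>
  For \<open>\<lambda>\<^bsub>1,\<infinity>\<^esub>\<close> take the indicator of a ball: it is constant on its support.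
  For \<open>\<lambda>\<^bsub>1,p\<^esub>\<close> take the logarithmic cutoff \<open>u x = max 0 (2 - \<delta> ln (1 + \<parallel>x\<parallel>))\<close>. Where \<open>K x y > 0\<close>,
  one of the two points is within distance \<open>1\<close> of the image under \<open>A\<close> of the other, so that
  \<open>1 + \<parallel>x\<parallel>\<close> and \<open>1 + \<parallel>y\<parallel>\<close> differ by at most a factor \<open>C\<close> depending on \<open>A\<close> only, and hence
  \<open>\<bar>u x - u y\<bar> \<le> \<delta> ln C\<close>. The Rayleigh quotient of \<open>u\<close> is thus at most \<open>D (\<delta> ln C)\<^sup>p\<close> with \<open>D\<close>
  independent of \<open>p\<close>, and its \<open>p\<close>-th root has limit superior at most \<open>\<delta> ln C\<close>, which is
  arbitrarily small.
\<close>

section \<open>Elementary estimates for the logarithmic cutoff\<close>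

definition log_cutoff :: "real \<Rightarrow> 'a::real_normed_vector \<Rightarrow> real" where
  "log_cutoff \<delta> x = max 0 (2 - \<delta> * ln (1 + norm x))"

lemma log_cutoff_nonneg: "0 \<le> log_cutoff \<delta> x"
  by (simp add: log_cutoff_def)

lemma log_cutoff_le_2: "0 \<le> \<delta> \<Longrightarrow> log_cutoff \<delta> x \<le> 2"
  by (simp add: log_cutoff_def)

lemma continuous_on_log_cutoff: "continuous_on UNIV (log_cutoff \<delta>)"
  unfolding log_cutoff_def[abs_def]
  by (intro continuous_intros) (simp add: add_nonneg_eq_0_iff)

lemma log_cutoff_measurable:
  "(log_cutoff \<delta> :: 'a::euclidean_space \<Rightarrow> real) \<in> borel_measurable lebesgue"
proof -
  have "(log_cutoff \<delta> :: 'a \<Rightarrow> real) \<in> borel_measurable borel"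
    by (intro borel_measurable_continuous_onI continuous_on_log_cutoff)
  then show ?thesis
    by (simp add: measurable_completion)
qed

lemma log_cutoff_eq_0:
  assumes "0 < \<delta>" "exp (2 / \<delta>) \<le> 1 + norm x"
  shows "log_cutoff \<delta> x = 0"
proof -
  have "2 / \<delta> \<le> ln (1 + norm x)"
    using assms by (simp add: ln_ge_iff add_pos_nonneg)
  then show ?thesis
    using assms by (simp add: log_cutoff_def field_simps)
qed

text \<open>Bounds the denominator of the Rayleigh quotient below by the volume of the unit ball,
  for every \<open>p\<close> at once.\<close>

lemma log_cutoff_ge_1:
  assumes "0 < \<delta>" "\<delta> * ln 2 \<le> 1" "norm x \<le> 1"
  shows "1 \<le> log_cutoff \<delta> x"
proof -
  have "ln (1 + norm x) \<le> ln 2"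
    using assms(3) by (intro ln_mono) (auto simp: add_pos_nonneg)
  then have "\<delta> * ln (1 + norm x) \<le> \<delta> * ln 2"
    using assms(1) by (simp add: mult_left_mono)
  then show ?thesis
    using assms(2) by (simp add: log_cutoff_def)
qed

text \<open>The logarithm turns a ratio of at most \<open>C\<close> into a difference of at most
  \<open>ln C\<close>, and truncation by \<open>max 0\<close> does not increase differences.\<close>

lemma log_cutoff_diff_le:
  fixes x y :: "'a::real_normed_vector"
  assumes "0 < \<delta>" "1 \<le> C" "1 + norm x \<le> C * (1 + norm y)" "1 + norm y \<le> C * (1 + norm x)"
  shows "\<bar>log_cutoff \<delta> x - log_cutoff \<delta> y\<bar> \<le> \<delta> * ln C"
proof -
  have *: "\<delta> * ln (1 + norm v) \<le> \<delta> * ln C + \<delta> * ln (1 + norm w)"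
    if "1 + norm v \<le> C * (1 + norm w)" for v w :: 'a
  proof -
    have "ln (1 + norm v) \<le> ln (C * (1 + norm w))"
      using that by (intro ln_mono) (auto simp: add_pos_nonneg)
    also have "\<dots> = ln C + ln (1 + norm w)"
      using assms(2) norm_ge_zero[of w] by (intro ln_mult_pos) linarith+
    finally show ?thesis
      using assms(1) by (simp flip: distrib_left add: mult_left_mono)
  qed
  have "0 \<le> \<delta> * ln C"
    using assms by simp
  with *[OF assms(3)] *[OF assms(4)] show ?thesis
    unfolding log_cutoff_def by linarith
qed

section \<open>Upper bounds for the Rayleigh quotients and their roots\<close>

text \<open>The integrand of the numerator vanishes outside the square of a fixed ball, so
  \<open>D\<close> is built from volumes. It may depend on \<open>\<delta>\<close>, but it is fixed
  before \<open>p\<close>, which lets its \<open>p\<close>-th root tend to \<open>1\<close>.\<close>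

lemma lambda1_le_log_cutoff:
  fixes K :: "real ^ 'n \<Rightarrow> real ^ 'n \<Rightarrow> real"
  assumes K_le: "\<And>x y. K x y \<le> M"
    and C: "1 \<le> C"
      "\<And>x y. K x y > 0 \<Longrightarrow> 1 + norm x \<le> C * (1 + norm y) \<and> 1 + norm y \<le> C * (1 + norm x)"
    and \<delta>: "0 < \<delta>" "\<delta> * ln 2 \<le> 1"
  obtains D where "0 < D" "\<And>p. 0 < p \<Longrightarrow> lambda1 p K \<le> ennreal (D * (\<delta> * ln C) powr p)"
proof -
  define u :: "real ^ 'n \<Rightarrow> real" where "u = log_cutoff \<delta>"
  \<comment> \<open>The cutoff vanishes once \<open>1 + norm x\<close> reaches
    \<open>exp (2 / \<delta>)\<close>. If it is nonzero at one of two points with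
    \<open>K x y > 0\<close>, the factor \<open>C\<close> bounds the other point as well, so both
    lie in the ball of radius \<open>R\<close>.\<close>
  define R where "R = C * exp (2 / \<delta>)"
  define B :: "(real ^ 'n) set" where "B = cball 0 R"
  define V where "V = measure lebesgue B"
  define W where "W = measure lebesgue (cball 0 1 :: (real ^ 'n) set)"
  \<comment> \<open>No sign is imposed on \<open>M\<close>; taking the maximum makes the bound on
    \<open>K\<close> usable as a nonnegative factor. In \<open>D\<close> the summand
    \<open>1\<close> ensures positivity even when \<open>N\<close> is \<open>0\<close>.\<close>
  define N where "N = max M 0"
  define D where "D = N * V * V / W + 1"
  have R: "exp (2 / \<delta>) \<le> R"
    using C(1) by (simp add: R_def)
  have V: "emeasure lebesgue B = ennreal V" "0 \<le> V" "B \<in> sets lebesgue"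
    unfolding V_def B_def by (auto simp: emeasure_eq_measure2)
  have W: "emeasure lebesgue (cball 0 1 :: (real ^ 'n) set) = ennreal W" "0 < W"
    unfolding W_def using content_ball_pos by (auto simp: emeasure_eq_measure2)
  have u_meas [measurable]: "u \<in> borel_measurable lebesgue"
    unfolding u_def by (rule log_cutoff_measurable)
  have near: "x \<in> B \<and> y \<in> B" if "K x y > 0" "u x \<noteq> u y" for x y
  proof -
    from C(2)[OF that(1)] have xy: "1 + norm x \<le> C * (1 + norm y)" "1 + norm y \<le> C * (1 + norm x)"
      by auto
    from that(2) have "1 + norm x < exp (2 / \<delta>) \<or> 1 + norm y < exp (2 / \<delta>)"
      using log_cutoff_eq_0[OF \<delta>(1)] unfolding u_def by (metis not_le)
    then have "1 + norm x \<le> R \<and> 1 + norm y \<le> R"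
    proof
      assume *: "1 + norm x < exp (2 / \<delta>)"
      then have "C * (1 + norm x) \<le> R"
        using C(1) by (simp add: R_def)
      with * xy R show ?thesis by linarith
    next
      assume *: "1 + norm y < exp (2 / \<delta>)"
      then have "C * (1 + norm y) \<le> R"
        using C(1) by (simp add: R_def)
      with * xy R show ?thesis by linarith
    qed
    then show ?thesis by (simp add: B_def)
  qed
  show thesis
  proof (rule that)
    show "0 < D"
      using V(2) W(2) by (simp add: D_def N_def add_nonneg_pos)
    fix p :: real assume p: "0 < p"
    have N: "0 \<le> N" by (simp add: N_def)
    let ?num = "\<integral>\<^sup>+ y. (\<integral>\<^sup>+ x. ennreal (K x y * \<bar>u x - u y\<bar> powr p) \<partial>lebesgue) \<partial>lebesgue"
    let ?den = "\<integral>\<^sup>+ x. ennreal (\<bar>u x\<bar> powr p) \<partial>lebesgue"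
    define E where "E = N * (\<delta> * ln C) powr p"
    have E: "0 \<le> E" by (simp add: E_def N_def)
    have bound: "ennreal (K x y * \<bar>u x - u y\<bar> powr p) \<le> ennreal E * indicator B x * indicator B y" for x y
    proof (cases "K x y > 0 \<and> u x \<noteq> u y")
      case True
      then have "K x y * \<bar>u x - u y\<bar> powr p \<le> E"
        using C(2)[of x y] K_le[of x y] p N unfolding E_def u_def
        by (intro mult_mono powr_mono2 log_cutoff_diff_le[OF \<delta>(1) C(1)]) (auto simp: N_def)
      then show ?thesis
        using near[of x y] True by (simp add: ennreal_leI)
    next
      \<comment> \<open>Either \<open>u x = u y\<close> and the power is \<open>0\<close>, or
        \<open>K x y\<close> is at most \<open>0\<close>; \<open>ennreal\<close> maps the resulting
        nonpositive product to \<open>0\<close>.\<close>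
      case False
      then have "K x y * \<bar>u x - u y\<bar> powr p \<le> 0"
        by (auto simp: mult_nonpos_nonneg)
      then show ?thesis
        by (simp add: ennreal_neg)
    qed
    have num: "?num \<le> ennreal (E * V * V)"
    proof -
      have "?num \<le> (\<integral>\<^sup>+ y. (\<integral>\<^sup>+ x. ennreal E * indicator B x * indicator B y \<partial>lebesgue) \<partial>lebesgue)"
        by (intro nn_integral_mono bound)
      also have "\<dots> = ennreal (E * V * V)"
        using V E borel_measurable_indicator[of B lebesgue]
        by (simp add: nn_integral_cmult nn_integral_multc ennreal_mult mult.assoc)
      finally show ?thesis .
    qed
    have den_ge: "ennreal W \<le> ?den"
    proof -
      have "ennreal W = (\<integral>\<^sup>+ x. indicator (cball 0 1) (x :: real ^ 'n) \<partial>lebesgue)"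
        by (simp add: W(1))
      also have "\<dots> \<le> ?den"
        using log_cutoff_ge_1[OF \<delta>] p
        by (intro nn_integral_mono) (force simp: u_def indicator_def intro: ge_one_powr_ge_zero)
      finally show ?thesis .
    qed
    have den_le: "?den < \<infinity>"
    proof -
      have "?den \<le> (\<integral>\<^sup>+ x. ennreal (2 powr p) * indicator B x \<partial>lebesgue)"
      proof (intro nn_integral_mono)
        fix x
        have "u x = 0" if "x \<notin> B"
          using that R log_cutoff_eq_0[OF \<delta>(1), of x] by (auto simp: B_def u_def)
        moreover have "\<bar>u x\<bar> powr p \<le> 2 powr p"
          using log_cutoff_nonneg[of \<delta> x] log_cutoff_le_2[of \<delta> x] \<delta>(1) p
          by (intro powr_mono2) (auto simp: u_def)
        ultimately show "ennreal (\<bar>u x\<bar> powr p) \<le> ennreal (2 powr p) * indicator B x"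
          by (auto simp: indicator_def ennreal_leI)
      qed
      also have "\<dots> < \<infinity>"
        using V by (simp add: nn_integral_cmult ennreal_mult_less_top)
      finally show ?thesis .
    qed
    have u_L: "u \<in> L_space p"
      using den_le u_meas by (simp add: L_space_def)
    have u_nz: "\<not> (AE x in lebesgue. u x = 0)"
    proof
      assume "AE x in lebesgue. u x = 0"
      then have "?den = 0"
        using p by (intro nn_integral_0_iff_AE[THEN iffD2]) (auto simp: u_meas)
      with den_ge W(2) show False by simp
    qed
    obtain d where d: "?den = ennreal d" "0 \<le> d"
      using den_le by (cases ?den) auto
    with den_ge W(2) have "W \<le> d" by simp
    have "lambda1 p K \<le> ?num / ?den"
      unfolding lambda1_def by (rule INF_lower) (use u_L u_nz in auto)
    also have "\<dots> \<le> ennreal (E * V * V) / ennreal d"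
      using num d(1) by (simp add: divide_right_mono_ennreal)
    also have "\<dots> = ennreal (E * V * V / d)"
      using E V(2) W(2) \<open>W \<le> d\<close> by (intro divide_ennreal) auto
    also have "\<dots> \<le> ennreal (E * V * V / W)"
      using E V(2) W(2) \<open>W \<le> d\<close> by (intro ennreal_leI divide_left_mono) auto
    also have "\<dots> \<le> ennreal (D * (\<delta> * ln C) powr p)"
      by (intro ennreal_leI) (simp add: E_def D_def algebra_simps)
    finally show "lambda1 p K \<le> ennreal (D * (\<delta> * ln C) powr p)" .
  qed
qed

text \<open>For each target \<open>e\<close>, a single \<open>\<delta>\<close> suffices: the root of
  the bound tends to \<open>\<delta> * ln C\<close>, which can be put below
  \<open>e\<close>.\<close>

lemma lambda1_root_tendsto_0:
  fixes K :: "real ^ 'n \<Rightarrow> real ^ 'n \<Rightarrow> real"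
  assumes K_le: "\<And>x y. K x y \<le> M"
    and C: "1 \<le> C"
      "\<And>x y. K x y > 0 \<Longrightarrow> 1 + norm x \<le> C * (1 + norm y) \<and> 1 + norm y \<le> C * (1 + norm x)"
  shows "((\<lambda>p. ennreal_powr (lambda1 p K) (1 / p)) \<longlongrightarrow> 0) at_top"
proof (rule order_tendstoI)
  fix e :: ennreal assume "0 < e"
  then obtain c where "0 < c" "c < e"
    using dense by blast
  then obtain r where r: "0 < r" "ennreal r < e"
    by (cases c) (auto simp: ennreal_less_zero_iff)
  \<comment> \<open>The bound \<open>1\<close> yields \<open>\<delta> * ln 2 \<le> 1\<close>, the
    other one \<open>\<delta> * ln C \<le> r / 2\<close>. Adding \<open>1\<close> to
    \<open>ln C\<close> avoids a zero divisor when \<open>C = 1\<close>.\<close>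
  define \<delta> where "\<delta> = min 1 (r / (2 * (ln C + 1)))"
  have \<delta>: "0 < \<delta>" "\<delta> * ln 2 \<le> 1" "\<delta> * ln C < r"
  proof -
    have L: "0 \<le> ln C" using C(1) by simp
    show "0 < \<delta>" using r L by (simp add: \<delta>_def add_nonneg_pos)
    have "\<delta> * ln 2 \<le> 1 * 1"
      using \<open>0 < \<delta>\<close> ln_2_less_1 by (intro mult_mono) (auto simp: \<delta>_def)
    then show "\<delta> * ln 2 \<le> 1" by simp
    have "\<delta> * ln C \<le> r / (2 * (ln C + 1)) * ln C"
      using L by (intro mult_right_mono) (auto simp: \<delta>_def)
    also have "\<dots> < r"
      using L r(1) by (simp add: field_simps add_nonneg_pos mult_nonneg_nonneg)
    finally show "\<delta> * ln C < r" .
  qed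
  obtain D where D: "0 < D" "\<And>p. 0 < p \<Longrightarrow> lambda1 p K \<le> ennreal (D * (\<delta> * ln C) powr p)"
    using lambda1_le_log_cutoff[where K = K and M = M and C = C and \<delta> = \<delta>] K_le C \<delta>(1,2) by metis
  have "((\<lambda>p. D powr (1 / p) * (\<delta> * ln C)) \<longlongrightarrow> D powr 0 * (\<delta> * ln C)) at_top"
    using D(1) by (intro tendsto_intros tendsto_divide_0[OF tendsto_const]
      filterlim_at_top_imp_at_infinity filterlim_ident) auto
  then have "\<forall>\<^sub>F p in at_top. D powr (1 / p) * (\<delta> * ln C) < r"
    using D(1) \<delta>(3) by (intro order_tendstoD(2)) auto
  then show "\<forall>\<^sub>F p in at_top. ennreal_powr (lambda1 p K) (1 / p) < e"
    using eventually_gt_at_top[of 0]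
  proof eventually_elim
    case (elim p)
    \<comment> \<open>\<open>ennreal_powr\<close> has a separate branch at infinity, where
      \<open>enn2real\<close> would give \<open>0\<close>; finiteness selects the real
      power.\<close>
    have fin: "lambda1 p K \<noteq> \<infinity>"
      using D(2)[OF elim(2)] by (auto simp: top_unique)
    have "enn2real (lambda1 p K) \<le> D * (\<delta> * ln C) powr p"
      using D(1) by (intro enn2real_leI D(2) elim) auto
    then have "enn2real (lambda1 p K) powr (1 / p) \<le> (D * (\<delta> * ln C) powr p) powr (1 / p)"
      using elim by (intro powr_mono2) auto
    also have "\<dots> = D powr (1 / p) * (\<delta> * ln C)"
      using elim D(1) \<delta>(1) C(1) by (simp add: powr_mult powr_powr)
    finally have "ennreal_powr (lambda1 p K) (1 / p) \<le> ennreal r"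
      using elim fin by (simp add: ennreal_powr_def ennreal_leI)
    then show ?case using r(2) by (rule le_less_trans)
  qed
\<comment> \<open>The lower half of the order criterion is vacuous, as nothing in
  \<open>ennreal\<close> lies below \<open>0\<close>.\<close>
qed simp

section \<open>The quotient for essentially bounded functions\<close>

lemma Linf_norm_on_eq_0:
  assumes "\<And>x. x \<in> S \<Longrightarrow> f x = 0"
  shows "Linf_norm_on S f = 0"
proof -
  \<comment> \<open>\<open>esssup\<close> is infinite by convention for a nonmeasurable function, so
    measurability has to be established; on \<open>S\<close> the function agrees with the constant
    \<open>0\<close>.\<close>
  have "(\<lambda>x. ennreal \<bar>f x\<bar>) \<in> borel_measurable (lebesgue_on S) \<longleftrightarrow>
      (\<lambda>x. 0 :: ennreal) \<in> borel_measurable (lebesgue_on S)"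
    using assms by (intro measurable_cong) (simp add: space_restrict_space)
  then have "esssup (lebesgue_on S) (\<lambda>x. ennreal \<bar>f x\<bar>) \<le> 0"
    using assms by (intro esssup_I AE_I2) (auto simp: space_restrict_space)
  then show ?thesis by (simp add: Linf_norm_on_def)
qed

text \<open>The open complement of \<open>S\<close> is one of the sets whose union is
  removed.\<close>

lemma ess_support_indicator_subset:
  assumes "closed S"
  shows "ess_support (indicator S) \<subseteq> S"
proof -
  have "- S \<in> {U. open U \<and> (AE x in lebesgue. x \<in> U \<longrightarrow> indicator S x = (0::real))}"
    using assms by (auto simp: open_Compl)
  then show ?thesis
    unfolding ess_support_def by blast
qed

lemma lambda1_inf_eq_0: "lambda1_inf K = 0" for K :: "real ^ 'n \<Rightarrow> real ^ 'n \<Rightarrow> real"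
proof -
  let ?S = "cball 0 1 :: (real ^ 'n) set"
  define u :: "real ^ 'n \<Rightarrow> real" where "u = indicator ?S"
  have u_meas [measurable]: "u \<in> borel_measurable lebesgue"
    unfolding u_def by (intro borel_measurable_indicator) simp
  have sub: "ess_support u \<subseteq> ?S"
    unfolding u_def by (rule ess_support_indicator_subset) simp
  have "closed (ess_support u)"
    unfolding ess_support_def by (auto intro!: open_Union simp: closed_def)
  with sub have "compact (ess_support u)"
    by (meson bounded_cball bounded_subset compact_eq_bounded_closed)
  moreover have "u \<in> Linf_space"
  proof -
    have "Linf_norm_on UNIV u \<le> 1"
      unfolding Linf_norm_on_def
      by (intro esssup_I measurable_restrict_space1) (measurable, simp add: u_def indicator_le_1)
    then show ?thesis
      using u_meas by (auto simp: Linf_space_def intro: le_less_trans)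
  qed
  moreover have "\<not> (AE x in lebesgue. u x = 0)"
  proof
    assume "AE x in lebesgue. u x = 0"
    then have "(\<integral>\<^sup>+ x. ennreal (u x) \<partial>lebesgue) = 0"
      by (intro nn_integral_0_iff_AE[THEN iffD2]) auto
    then have "emeasure lebesgue ?S = 0"
      by (simp add: u_def ennreal_indicator)
    then show False
      using content_cball_pos[of 1 "0 :: real ^ 'n"] by (simp add: measure_def)
  qed
  moreover have "Linf_norm_on {(x, y). x \<in> ess_support u \<and> y \<in> ess_support u \<and> K x y > 0}
      (\<lambda>(x, y). u x - u y) = 0"
  proof -
    \<comment> \<open>The essential support lies in the closed ball, where \<open>u\<close> is
      \<open>1\<close> at every point, boundary included; the differences therefore vanish
      pointwise.\<close>
    have "u x = 1" if "x \<in> ess_support u" for x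
      using sub that by (auto simp: u_def)
    then show ?thesis
      by (intro Linf_norm_on_eq_0) auto
  qed
  \<comment> \<open>In \<open>ennreal\<close>, \<open>0 / c\<close> is \<open>0\<close> for every
    \<open>c\<close>, including \<open>0\<close> and infinity.\<close>
  ultimately have "lambda1_inf K \<le> 0 / Linf_norm_on (ess_support u) u"
    unfolding lambda1_inf_def by (intro INF_lower2[of u]) auto
  then show ?thesis by simp
qed

section \<open>Comparability of points joined by the kernel\<close>

text \<open>A positive kernel value puts \<open>y\<close> within distance \<open>1\<close> of
  \<open>a x\<close>, or \<open>x\<close> within distance \<open>1\<close> of \<open>a y\<close>.
  Boundedness of \<open>a\<close> controls one norm by the other, and boundedness of its left
  inverse \<open>b\<close> gives the reverse control.\<close>

lemma kernel_of_comparable: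
  fixes \<psi> :: "real ^ 'n \<Rightarrow> real"
  assumes "linear a" "linear b" "\<And>x. b (a x) = x"
    and supp: "\<And>x. \<psi> x \<noteq> 0 \<Longrightarrow> norm x \<le> 1"
  obtains C where "1 \<le> C"
    "\<And>x y. kernel_of \<psi> a x y > 0 \<Longrightarrow> 1 + norm x \<le> C * (1 + norm y) \<and> 1 + norm y \<le> C * (1 + norm x)"
proof -
  obtain P where P: "0 < P" "\<And>x. norm (a x) \<le> P * norm x"
    using linear_bounded_pos[OF assms(1)] by blast
  obtain Q where Q: "0 < Q" "\<And>x. norm (b x) \<le> Q * norm x"
    using linear_bounded_pos[OF assms(2)] by blast
  \<comment> \<open>\<open>C\<close> dominates both factors that occur: \<open>1 + Q\<close> for
    bounding \<open>1 + norm x\<close>, and \<open>2 + P\<close> for bounding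
    \<open>1 + norm y\<close>.\<close>
  define C where "C = 2 + P + Q"
  have C: "1 + norm x \<le> C * (1 + norm y) \<and> 1 + norm y \<le> C * (1 + norm x)"
    if "norm (y - a x) \<le> 1" for x y
  proof
    have "norm x \<le> Q * norm (a x)"
      using Q(2)[of "a x"] assms(3) by simp
    also have "norm (a x) \<le> norm y + 1"
      using that norm_triangle_ineq3[of y "a x"] by linarith
    finally have "norm x \<le> Q * (norm y + 1)"
      using Q(1) by simp
    moreover have "0 \<le> P * (1 + norm y) + 2 * norm y"
      using P(1) by simp
    ultimately show "1 + norm x \<le> C * (1 + norm y)"
      by (simp add: C_def algebra_simps)
    have "norm y \<le> norm (a x) + 1"
      using that norm_triangle_ineq2[of y "a x"] by linarith
    also have "\<dots> \<le> P * norm x + 1"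
      using P(2) by simp
    finally have "norm y \<le> P * norm x + 1" .
    moreover have "0 \<le> Q * (1 + norm x) + P + 2 * norm x"
      using P(1) Q(1) by simp
    ultimately show "1 + norm y \<le> C * (1 + norm x)"
      by (simp add: C_def algebra_simps)
  qed
  \<comment> \<open>A positive sum has a nonzero summand. Exchanging \<open>x\<close> and
    \<open>y\<close> swaps the two alternatives and preserves the pair of inequalities, so
    \<open>C\<close> serves both.\<close>
  have "norm (y - a x) \<le> 1 \<or> norm (x - a y) \<le> 1" if "kernel_of \<psi> a x y > 0" for x y
    using that supp[of "y - a x"] supp[of "x - a y"] unfolding kernel_of_def by force
  then show thesis
    using P(1) Q(1) C by (intro that[of C]) (auto simp: C_def)
qed

theorem theorem1p3:
  fixes A :: "real ^ 'n ^ 'n" and a :: "real ^ 'n \<Rightarrow> real ^ 'n"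
    and \<psi> :: "real ^ 'n \<Rightarrow> real" and K :: "real ^ 'n \<Rightarrow> real ^ 'n \<Rightarrow> real"
  assumes "invertible A"
    and "a = (\<lambda>x. A *v x)"
    and "\<psi> \<in> borel_measurable lebesgue"
    and "\<And>x. \<psi> x \<ge> 0"
    and "bounded (range \<psi>)"
    and "closure {x. \<psi> x \<noteq> 0} \<subseteq> cball 0 1"
    and "K = kernel_of \<psi> a"
  shows "((\<lambda>p. ennreal_powr (lambda1 p K) (1 / p)) \<longlongrightarrow> lambda1_inf K) at_top \<and>
    lambda1_inf K = 0"
proof -
  obtain A' where A': "A' ** A = mat 1"
    using assms(1) by (auto simp: invertible_def)
  have "norm x \<le> 1" if "\<psi> x \<noteq> 0" for x
    using that assms(6) closure_subset[of "{x. \<psi> x \<noteq> 0}"] by auto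
  then obtain C where C: "1 \<le> C"
    "\<And>x y. K x y > 0 \<Longrightarrow> 1 + norm x \<le> C * (1 + norm y) \<and> 1 + norm y \<le> C * (1 + norm x)"
    using kernel_of_comparable[of a "\<lambda>x. A' *v x" \<psi>] A'
    by (auto simp: assms(2,7) matrix_vector_mul_assoc)
  obtain M where "\<And>x. \<bar>\<psi> x\<bar> \<le> M"
    using assms(5) by (auto simp: bounded_iff)
  then have "K x y \<le> M + M" for x y
    unfolding assms(7) kernel_of_def by (intro add_mono) (auto dest: abs_le_D1)
  from lambda1_root_tendsto_0[OF this C] show ?thesis
    by (simp add: lambda1_inf_eq_0)
qed

end
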